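(* If $\mathcal{A}$ is a Luzin family, then the space $\Psi(\mathcal{A})$ is strongly $2$-star-Rothberger.
   Context: A family $\mathcal{A}$ of infinite subsets of $\omega$ is almost disjoint if any two distinct members have finite intersection. A Luzin family is an almost disjoint family $\mathcal{A}=\{a_\alpha:\alpha<\omega_1\}$ (enumerated without repetitions) such that for each $\alpha<\omega_1$ and each $n\in\omega$ the set $\{\beta<\alpha: a_\beta\cap a_\alpha\subseteq n\}$ is finite (here $n=\{0,\dots,n-1\}$). For an almost disjoint family $\mathcal{A}$, $\Psi(\mathcal{A})=\mathcal{A}\cup\omega$ with the topology in which points of $\omega$ are isolated and the basic neighbourhoods of $a\in\mathcal{A}$ are the sets $\{a\}\cup(a\setminus F)$ with $F\subseteq\omega$ finite. For a family $\mathcal{U}$ of subsets of $X$ and $A\subseteq X$, $St(A,\mathcal{U})=\bigcup\{U\in\mathcal{U}:U\cap A\neq\emptyset\}$, $St^2(A,\mathcal{U})=St(St(A,\mathcal{U}),\mathcal{U})$, and $St^2(x,\mathcal{U})=St^2(\{x\},\mathcal{U})$. A space $X$ is strongly $2$-star-Rothberger if for every sequence $\{\mathcal{U}_n:n\in\omega\}$ of open covers of $X$ there are points $x_n\in X$ ($n\in\omega$) such that $\{St^2(x_n,\mathcal{U}_n):n\in\omega\}$ covers $X$. *)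

theory Defs
  imports "HOL-Analysis.Analysis" "HOL-Library.Countable_Set_Type"
begin

text \<open>
  The ordinal \<open>\<omega>\<^sub>1\<close>, represented as the library's successor cardinal of \<open>natLeq\<close>: a
  well-order of least possible order type among the uncountable ones. Its carrier
  \<open>Field omega1\<close> happens to consist of objects of type \<open>nat set\<close>, which serve only as
  names for the countable ordinals.
\<close>

definition omega1 :: "nat set rel" where
  "omega1 = cardSuc natLeq"

lemma Card_order_omega1: "Card_order omega1"
  unfolding omega1_def by (rule cardSuc_Card_order[OF natLeq_Card_order])

lemma uncountable_Field_omega1: "\<not> countable (Field omega1)"
proof
  assume "countable (Field omega1)"
  then have "(card_of (Field omega1), natLeq) \<in> ordLeq"
    by (simp add: countable_card_le_natLeq)
  then have "(omega1, natLeq) \<in> ordLeq"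
    using card_of_Field_ordIso[OF Card_order_omega1] ordIso_ordLeq_trans ordIso_symmetric
    by blast
  moreover have "(natLeq, omega1) \<in> ordLess"
    unfolding omega1_def by (rule cardSuc_greater[OF natLeq_Card_order])
  ultimately show False
    using not_ordLess_ordLeq by blast
qed

lemma countable_underS_omega1: "countable (underS omega1 \<alpha>)"
proof (cases "\<alpha> \<in> Field omega1")
  case True
  have "(card_of (underS omega1 \<alpha>), cardSuc natLeq) \<in> ordLess"
    using card_of_underS[OF Card_order_omega1 True] by (simp add: omega1_def)
  then show ?thesis
    by (simp add: countable_card_le_natLeq natLeq_Card_order card_of_Card_order
        cardSuc_ordLeq_ordLess)
next
  case False
  then show ?thesis by (simp add: underS_empty)
qed

definition almost_disjoint :: "nat set set \<Rightarrow> bool" where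
  "almost_disjoint \<A> \<longleftrightarrow>
     (\<forall>a\<in>\<A>. infinite a) \<and> (\<forall>a\<in>\<A>. \<forall>b\<in>\<A>. a \<noteq> b \<longrightarrow> finite (a \<inter> b))"

text \<open>\<open>underS omega1 \<alpha>\<close> is the set of all \<open>\<beta> < \<alpha>\<close>.\<close>

definition Luzin_family :: "nat set set \<Rightarrow> bool" where
  "Luzin_family \<A> \<longleftrightarrow>
     almost_disjoint \<A> \<and>
     (\<exists>a :: nat set \<Rightarrow> nat set.
        bij_betw a (Field omega1) \<A> \<and>
        (\<forall>\<alpha>\<in>Field omega1. \<forall>n :: nat.
           finite {\<beta> \<in> underS omega1 \<alpha>. a \<beta> \<inter> a \<alpha> \<subseteq> {..<n}}))"

text \<open>
  The points of \<open>\<Psi>(\<A>)\<close> are \<open>Inl n\<close> for \<open>n \<in> \<omega>\<close> and \<open>Inr a\<close> for \<open>a \<in> \<A>\<close>.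
\<close>

definition Psi_nbhd :: "nat set \<Rightarrow> nat set \<Rightarrow> (nat + nat set) set" where
  "Psi_nbhd a F = insert (Inr a) (Inl ` (a - F))"

definition Psi :: "nat set set \<Rightarrow> (nat + nat set) topology" where
  "Psi \<A> = topology (\<lambda>U. U \<subseteq> range Inl \<union> Inr ` \<A> \<and>
     (\<forall>a. Inr a \<in> U \<longrightarrow> (\<exists>F. finite F \<and> Psi_nbhd a F \<subseteq> U)))"

lemma istopology_Psi:
  "istopology (\<lambda>U. U \<subseteq> range Inl \<union> Inr ` \<A> \<and>
     (\<forall>a. Inr a \<in> U \<longrightarrow> (\<exists>F. finite F \<and> Psi_nbhd a F \<subseteq> U)))"
  unfolding istopology_def
proof (intro conjI allI impI)
  fix S T :: "(nat + nat set) set" and a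
  assume S: "S \<subseteq> range Inl \<union> Inr ` \<A> \<and>
      (\<forall>a. Inr a \<in> S \<longrightarrow> (\<exists>F. finite F \<and> Psi_nbhd a F \<subseteq> S))"
    and T: "T \<subseteq> range Inl \<union> Inr ` \<A> \<and>
      (\<forall>a. Inr a \<in> T \<longrightarrow> (\<exists>F. finite F \<and> Psi_nbhd a F \<subseteq> T))"
  show "S \<inter> T \<subseteq> range Inl \<union> Inr ` \<A>" using S by blast
  assume "Inr a \<in> S \<inter> T"
  then obtain F G where "finite F" "Psi_nbhd a F \<subseteq> S" "finite G" "Psi_nbhd a G \<subseteq> T"
    using S T by (metis IntE)
  then have "finite (F \<union> G) \<and> Psi_nbhd a (F \<union> G) \<subseteq> S \<inter> T"
    by (auto simp: Psi_nbhd_def)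
  then show "\<exists>F. finite F \<and> Psi_nbhd a F \<subseteq> S \<inter> T" by blast
next
  fix K :: "(nat + nat set) set set" and a
  assume K: "\<forall>S\<in>K. S \<subseteq> range Inl \<union> Inr ` \<A> \<and>
      (\<forall>a. Inr a \<in> S \<longrightarrow> (\<exists>F. finite F \<and> Psi_nbhd a F \<subseteq> S))"
  show "\<Union>K \<subseteq> range Inl \<union> Inr ` \<A>" using K by blast
  assume "Inr a \<in> \<Union>K"
  then obtain S where "S \<in> K" "Inr a \<in> S" by blast
  then show "\<exists>F. finite F \<and> Psi_nbhd a F \<subseteq> \<Union>K"
    using K by (meson Union_upper subset_trans)
qed

lemma openin_Psi:
  "openin (Psi \<A>) U \<longleftrightarrow> U \<subseteq> range Inl \<union> Inr ` \<A> \<and>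
     (\<forall>a. Inr a \<in> U \<longrightarrow> (\<exists>F. finite F \<and> Psi_nbhd a F \<subseteq> U))"
  unfolding Psi_def by (simp only: topology_inverse'[OF istopology_Psi])

lemma openin_Psi_isolated: "openin (Psi \<A>) {Inl n}"
  by (auto simp: openin_Psi)

lemma openin_Psi_nbhd: "a \<in> \<A> \<Longrightarrow> finite F \<Longrightarrow> openin (Psi \<A>) (Psi_nbhd a F)"
  by (auto simp: openin_Psi Psi_nbhd_def)

lemma topspace_Psi: "topspace (Psi \<A>) = range Inl \<union> Inr ` \<A>"
proof
  show "topspace (Psi \<A>) \<subseteq> range Inl \<union> Inr ` \<A>"
    using openin_topspace[of "Psi \<A>"] by (simp only: openin_Psi)
  have "openin (Psi \<A>) (range Inl \<union> Inr ` \<A>)"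
    by (auto simp: openin_Psi Psi_nbhd_def intro: exI[of _ "{}"])
  then show "range Inl \<union> Inr ` \<A> \<subseteq> topspace (Psi \<A>)"
    by (rule openin_subset)
qed

definition open_cover :: "'a topology \<Rightarrow> 'a set set \<Rightarrow> bool" where
  "open_cover X \<U> \<longleftrightarrow> (\<forall>U\<in>\<U>. openin X U) \<and> \<Union>\<U> = topspace X"

definition St :: "'a set \<Rightarrow> 'a set set \<Rightarrow> 'a set" where
  "St A \<U> = \<Union>{U \<in> \<U>. U \<inter> A \<noteq> {}}"

definition St2 :: "'a set \<Rightarrow> 'a set set \<Rightarrow> 'a set" where
  "St2 A \<U> = St (St A \<U>) \<U>"

definition strongly_2_star_Rothberger :: "'a topology \<Rightarrow> bool" where
  "strongly_2_star_Rothberger X \<longleftrightarrow>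
     (\<forall>\<U> :: nat \<Rightarrow> 'a set set. (\<forall>n. open_cover X (\<U> n)) \<longrightarrow>
        (\<exists>x :: nat \<Rightarrow> 'a. (\<forall>n. x n \<in> topspace X) \<and>
           (\<Union>n. St2 {x n} (\<U> n)) = topspace X))"

end

theory Submission
  imports Defs
begin

text \<open>
  A Luzin family is inseparable: two uncountable subfamilies cannot have all their mutual
  intersections bounded by a single \<open>n\<close> (\<open>Luzin_family_inseparable\<close>). For one open cover this
  already yields a single \<open>m \<in> \<omega>\<close> whose second star contains all but countably many members of
  the family (\<open>Luzin_family_St2_co_countable\<close>). Attach to each \<open>a \<in> \<A>\<close> a number \<open>k a\<close> such that
  some member of the cover contains \<open>a\<close> together with the tail of \<open>a\<close> from \<open>k a\<close> on. By
  pigeonhole, uncountably many \<open>a\<close> share the value \<open>k a\<close> and share a point \<open>m\<close> of that tail, so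
  the first star of \<open>m\<close> contains the tails of all of them. A member \<open>b\<close> outside the second star
  of \<open>m\<close> has a tail disjoint from all those tails; uncountably many such \<open>b\<close> would, after
  another pigeonhole on \<open>k b\<close>, contradict inseparability.

  Given a sequence of covers, this \<open>m\<close> is the point chosen for the first one. The rest of the
  space is then countable, and its points can be chosen one at a time for the remaining covers,
  since every point lies in its own second star.
\<close>

lemma uncountable_fibre:
  fixes f :: "'a \<Rightarrow> 'b::countable"
  assumes "uncountable S"
  obtains y where "uncountable {x \<in> S. f x = y}"
proof -
  have "countable S" if "\<And>y. countable {x \<in> S. f x = y}"
  proof -
    have "countable (\<Union>y. {x \<in> S. f x = y})"
      using that by (intro countable_UN) auto
    moreover have "(\<Union>y. {x \<in> S. f x = y}) = S" by auto
    ultimately show ?thesis by simp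
  qed
  then show thesis using assms that by blast
qed

text \<open>
  A countable set of ordinals has only countably many ordinals that are not strictly above it.
\<close>

lemma uncountable_omega1_bounds_countable:
  assumes C: "countable C" "C \<subseteq> Field omega1"
    and E: "uncountable E" "E \<subseteq> Field omega1"
  obtains \<beta> where "\<beta> \<in> E" "C \<subseteq> underS omega1 \<beta>"
proof -
  have wo: "Well_order omega1"
    using Card_order_omega1 card_order_on_well_order_on by blast
  have "countable (\<Union>\<gamma>\<in>C. insert \<gamma> (underS omega1 \<gamma>))"
    using C(1) countable_underS_omega1 by auto
  then obtain \<beta> where \<beta>: "\<beta> \<in> E" "\<beta> \<notin> (\<Union>\<gamma>\<in>C. insert \<gamma> (underS omega1 \<gamma>))"
    using E(1) by (meson countable_subset subsetI)
  have "\<gamma> \<in> underS omega1 \<beta>" if "\<gamma> \<in> C" for \<gamma>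
  proof -
    have "\<beta> \<noteq> \<gamma>" "(\<beta>, \<gamma>) \<notin> omega1"
      using \<beta>(2) that by (auto simp: underS_def)
    moreover have "total_on (Field omega1) omega1"
      using wo by (simp add: well_order_on_def linear_order_on_def)
    ultimately have "(\<gamma>, \<beta>) \<in> omega1"
      using \<beta>(1) that C(2) E(2) unfolding total_on_def by blast
    with \<open>\<beta> \<noteq> \<gamma>\<close> show ?thesis by (simp add: underS_def)
  qed
  with \<beta>(1) show thesis using that by blast
qed

text \<open>
  Infinitely many members of \<open>D\<close> lie below some member of \<open>E\<close> in the enumeration, whereas only
  finitely many of those below it may meet it within \<open>{..<n}\<close>.
\<close>

lemma Luzin_family_inseparable:
  assumes L: "Luzin_family \<A>"
    and D: "D \<subseteq> \<A>" "uncountable D"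
    and E: "E \<subseteq> \<A>" "uncountable E"
  obtains d e where "d \<in> D" "e \<in> E" "\<not> d \<inter> e \<subseteq> {..<n}"
proof -
  obtain a where bij: "bij_betw a (Field omega1) \<A>"
    and fin: "\<And>\<alpha>. \<alpha> \<in> Field omega1 \<Longrightarrow>
      finite {\<beta> \<in> underS omega1 \<alpha>. a \<beta> \<inter> a \<alpha> \<subseteq> {..<n}}"
    using L unfolding Luzin_family_def by blast
  define pre where "pre S = {\<alpha> \<in> Field omega1. a \<alpha> \<in> S}" for S
  have uncountable_pre: "uncountable (pre S)" if "S \<subseteq> \<A>" "uncountable S" for S
  proof -
    have "S = a ` pre S"
      using bij that(1) unfolding pre_def bij_betw_def by blast
    then show ?thesis using that(2) by (metis countable_image)
  qed
  have "infinite (pre D)"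
    using uncountable_pre[OF D] by (auto dest: countable_finite)
  then obtain C where C: "countable C" "infinite C" "C \<subseteq> pre D"
    using infinite_countable_subset' by blast
  obtain \<beta> where \<beta>: "\<beta> \<in> pre E" "C \<subseteq> underS omega1 \<beta>"
    using uncountable_omega1_bounds_countable[OF C(1) _ uncountable_pre[OF E]] C(3)
    unfolding pre_def by blast
  have "\<not> C \<subseteq> {\<gamma> \<in> underS omega1 \<beta>. a \<gamma> \<inter> a \<beta> \<subseteq> {..<n}}"
    using fin[of \<beta>] \<beta>(1) C(2) finite_subset by (auto simp: pre_def)
  then obtain \<gamma> where "\<gamma> \<in> C" "\<not> a \<gamma> \<inter> a \<beta> \<subseteq> {..<n}"
    using \<beta>(2) by blast
  then show thesis
    using that[of "a \<gamma>" "a \<beta>"] C(3) \<beta>(1) by (auto simp: pre_def)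
qed

lemma open_cover_Psi_tail:
  assumes "open_cover (Psi \<A>) \<U>" "a \<in> \<A>"
  obtains U k where "U \<in> \<U>" "Inr a \<in> U" "\<And>i. i \<in> a \<Longrightarrow> k \<le> i \<Longrightarrow> Inl i \<in> U"
proof -
  obtain U where U: "U \<in> \<U>" "Inr a \<in> U"
    using assms unfolding open_cover_def topspace_Psi by blast
  then obtain F where F: "finite F" "Psi_nbhd a F \<subseteq> U"
    using assms(1) unfolding open_cover_def openin_Psi by blast
  obtain k where "F \<subseteq> {..<k}"
    using F(1) finite_nat_iff_bounded by blast
  then have "Inl i \<in> U" if "i \<in> a" "k \<le> i" for i
    using F(2) that by (force simp: Psi_nbhd_def)
  with U show thesis by (rule that)
qed

lemma Luzin_family_St2_co_countable:
  assumes L: "Luzin_family \<A>" and cov: "open_cover (Psi \<A>) \<U>"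
  obtains m where "countable {b \<in> \<A>. Inr b \<notin> St2 {Inl m} \<U>}"
proof (cases "countable \<A>")
  case True
  then have "countable {b \<in> \<A>. Inr b \<notin> St2 {Inl 0} \<U>}"
    by (rule countable_subset[rotated]) blast
  then show thesis by (rule that)
next
  case False
  have "\<exists>U k. U \<in> \<U> \<and> Inr a \<in> U \<and> (\<forall>i\<in>a. k \<le> i \<longrightarrow> Inl i \<in> U)" if "a \<in> \<A>" for a
    using open_cover_Psi_tail[OF cov that] by metis
  then obtain U k where U: "\<And>a. a \<in> \<A> \<Longrightarrow> U a \<in> \<U>" "\<And>a. a \<in> \<A> \<Longrightarrow> Inr a \<in> U a"
    and k: "\<And>a i. a \<in> \<A> \<Longrightarrow> i \<in> a \<Longrightarrow> k a \<le> i \<Longrightarrow> Inl i \<in> U a"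
    by metis
  have "\<exists>i\<in>a. k a \<le> i" if "a \<in> \<A>" for a
  proof -
    have "infinite a"
      using L that by (simp add: Luzin_family_def almost_disjoint_def)
    then show ?thesis by (auto simp: infinite_nat_iff_unbounded_le)
  qed
  then obtain p where p: "\<And>a. a \<in> \<A> \<Longrightarrow> p a \<in> a" "\<And>a. a \<in> \<A> \<Longrightarrow> k a \<le> p a"
    by metis
  obtain km where "uncountable {a \<in> \<A>. (k a, p a) = km}"
    using uncountable_fibre[OF False, of "\<lambda>a. (k a, p a)"] by blast
  then obtain k\<^sub>0 m where D: "uncountable {a \<in> \<A>. k a = k\<^sub>0 \<and> p a = m}" (is "uncountable ?D")
    by (cases km) simp
  have "countable {b \<in> \<A>. Inr b \<notin> St2 {Inl m} \<U>}" (is "countable ?E")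
  proof (rule ccontr)
    assume "uncountable ?E"
    then obtain k\<^sub>1 where E: "uncountable {b \<in> ?E. k b = k\<^sub>1}"
      using uncountable_fibre[of ?E k] by blast
    obtain d e where d: "d \<in> ?D" and e: "e \<in> {b \<in> ?E. k b = k\<^sub>1}"
      and "\<not> d \<inter> e \<subseteq> {..<max k\<^sub>0 k\<^sub>1}"
      using Luzin_family_inseparable[OF L _ D _ E, of "max k\<^sub>0 k\<^sub>1"] by blast
    then obtain i where i: "i \<in> d" "i \<in> e" "max k\<^sub>0 k\<^sub>1 \<le> i"
      by (meson lessThan_iff not_less IntE subsetI)
    \<comment> \<open>The tails of \<open>d\<close> and \<open>e\<close> meet in \<open>i\<close>, which gives the chain \<open>m\<close>, \<open>i\<close>, \<open>e\<close> of length two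
      through the members \<open>U d\<close> and \<open>U e\<close> of the cover.\<close>
    have "Inl m \<in> U d" using d k[of d m] p[of d] by auto
    moreover have "Inl i \<in> U d" using d k[of d i] i by auto
    ultimately have "Inl i \<in> St {Inl m} \<U>"
      using d U(1)[of d] by (auto simp: St_def)
    moreover have "Inl i \<in> U e" using e k[of e i] i by auto
    ultimately have "Inr e \<in> St2 {Inl m} \<U>"
      using e U[of e] by (auto simp: St2_def St_def[of "St {Inl m} \<U>"])
    with e show False by simp
  qed
  then show thesis by (rule that)
qed

lemma subset_St_open_cover:
  assumes "open_cover X \<U>" "A \<subseteq> topspace X"
  shows "A \<subseteq> St A \<U>"
  using assms by (fastforce simp: open_cover_def St_def)

lemma St_subset_topspace:
  assumes "open_cover X \<U>"
  shows "St A \<U> \<subseteq> topspace X"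
  using assms by (auto simp: open_cover_def St_def)

lemma mem_St2_open_cover:
  assumes "open_cover X \<U>" "x \<in> topspace X"
  shows "x \<in> St2 {x} \<U>"
  using subset_St_open_cover[OF assms(1) St_subset_topspace[OF assms(1)], of "{x}"]
    subset_St_open_cover[OF assms(1), of "{x}"] assms(2)
  by (auto simp: St2_def)

theorem proposition4p2:
  fixes \<A> :: "nat set set"
  assumes "Luzin_family \<A>"
  shows "strongly_2_star_Rothberger (Psi \<A>)"
  unfolding strongly_2_star_Rothberger_def
proof (intro allI impI)
  fix \<U> :: "nat \<Rightarrow> (nat + nat set) set set"
  assume "\<forall>n. open_cover (Psi \<A>) (\<U> n)"
  then have cov: "open_cover (Psi \<A>) (\<U> n)" for n by blast
  obtain m where m: "countable {b \<in> \<A>. Inr b \<notin> St2 {Inl m} (\<U> 0)}" (is "countable ?E")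
    using Luzin_family_St2_co_countable[OF assms cov] .
  let ?R = "range Inl \<union> Inr ` ?E :: (nat + nat set) set"
  have R: "countable ?R" "?R \<noteq> {}"
    using m by (simp_all add: countable_image)
  \<comment> \<open>Cover \<open>0\<close> is used up by \<open>m\<close>; covers \<open>1, 2, \<dots>\<close> take care of the countable remainder.\<close>
  define x where "x n = (case n of 0 \<Rightarrow> Inl m | Suc i \<Rightarrow> from_nat_into ?R i)" for n
  have x_topspace: "x n \<in> topspace (Psi \<A>)" for n
    using from_nat_into[OF R(2)] by (force simp: x_def topspace_Psi split: nat.split)
  have "y \<in> (\<Union>n. St2 {x n} (\<U> n))" if "y \<in> topspace (Psi \<A>)" for y
  proof (cases "y \<in> ?R")
    case True
    then obtain i where "from_nat_into ?R i = y"
      using from_nat_into_surj[OF R(1)] by blast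
    then have "y = x (Suc i)" by (simp add: x_def)
    then show ?thesis using mem_St2_open_cover[OF cov that] by blast
  next
    case False
    then have "y \<in> St2 {x 0} (\<U> 0)"
      using that by (auto simp: x_def topspace_Psi)
    then show ?thesis by blast
  qed
  moreover have "St2 {x n} (\<U> n) \<subseteq> topspace (Psi \<A>)" for n
    unfolding St2_def by (rule St_subset_topspace[OF cov])
  ultimately have "(\<Union>n. St2 {x n} (\<U> n)) = topspace (Psi \<A>)" by blast
  with x_topspace show "\<exists>x. (\<forall>n. x n \<in> topspace (Psi \<A>)) \<and>
      (\<Union>n. St2 {x n} (\<U> n)) = topspace (Psi \<A>)" by blast
qed

end
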